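(* Let $c\in\{c_{\mathsf{All}},c_{\mathsf{None}},c_{\mathsf{Match}}\}$. There exists an LDQL query $q$ for which there does not exist a SPARQL graph pattern $P$ such that $[\![P]\!]^{\mathsf R(c,S)}_W=[\![q]\!]^S_W$ for every Web of Linked Data $W$ and every finite $S\subseteq\mathcal U$.
   Context: **Data model.** $\mathcal U$ (URIs), $\mathcal B$ (blank nodes), $\mathcal L$ (literals), $\mathcal V$ (variables, written $?v,?x,\dots$) and $\mathcal D$ (documents) are pairwise disjoint infinite sets. An RDF triple is an element of $\mathcal T=(\mathcal U\cup\mathcal B)\times\mathcal U\times(\mathcal U\cup\mathcal B\cup\mathcal L)$; $\mathrm{uris}(t)$ is the set of URIs in the triple $t$. Each document $d$ carries a finite set of triples $\mathrm{data}(d)\subseteq\mathcal T$, distinct documents using disjoint sets of blank nodes. A Web of Linked Data is $W=\langle D,adoc\rangle$ with $D\subseteq\mathcal D$ finite and $adoc:\mathcal U\to D$ a partial surjective function with domain $\mathrm{dom}(adoc)$. When quantifying over all Webs, the assignment $\mathrm{data}$ also varies over all possibilities. The link graph $\mathcal G_W$ has node set $D$ and edges $\langle d,(t,u),d'\rangle$ for all $d\in D$, $t\in\mathrm{data}(d)$, $u\in\mathrm{uris}(t)\cap\mathrm{dom}(adoc)$, $d'=adoc(u)$. **SPARQL.** A solution mapping $\mu$ is a partial function with finite domain from $\mathcal V$ to $\mathcal U\cup\mathcal B\cup\mathcal L$; $\mu[\alpha]=\mu(\alpha)$ if $\alpha\in\mathrm{dom}(\mu)$, else $\mu[\alpha]=\alpha$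 (extended componentwise to triples). $\mu,\mu'$ are compatible if they agree on $\mathrm{dom}(\mu)\cap\mathrm{dom}(\mu')$. $\Omega_1\Join\Omega_2=\{\mu_1\cup\mu_2\mid\mu_i\in\Omega_i\text{ compatible}\}$. An RDF dataset $\mathfrak D$ consists of a default graph and finitely or infinitely many named graphs $\langle u,G_u\rangle$ with pairwise distinct names $u\in\mathcal U$. Graph patterns: finite sets $B$ of triple patterns from $(\mathcal U\cup\mathcal L\cup\mathcal V)\times(\mathcal U\cup\mathcal V)\times(\mathcal U\cup\mathcal L\cup\mathcal V)$ (basic graph patterns, possibly the empty one $\{\,\}$; a triple pattern is identified with a singleton), and $(P_1\,\mathsf{AND}\,P_2)$, $(P_1\,\mathsf{UNION}\,P_2)$, $(P_1\,\mathsf{OPT}\,P_2)$, $(P_1\,\mathsf{FILTER}\,R)$, $(\mathsf{GRAPH}\ c\ P_1)$ with $c\in\mathcal U\cup\mathcal V$, $(P_1\,\mathsf{BIND}(e\,\mathsf{AS}\,?v))$ with $e\in\mathcal U\cup\mathcal L\cup\mathcal V$ and $?v$ not occurring in $P_1$. Filter conditions are Boolean combinations of $\mathrm{bound}(?x)$, $?x=c$, $?x=?y$ (atoms with an unbound variable are false). Evaluation $[\![P]\!]^{\mathfrak D}_G$: $[\![B]\!]=\{\mu\mid\mathrm{dom}(\mu)=\mathrm{var}(B),\mu[B]\subseteq G\}$; $\mathsf{AND}$ is $\Join$; $\mathsf{UNION}$ is $\cup$; $\mathsf{OPT}$ gives $(\Omega_1\Join\Omega_2)\cup\{\mu\in\Omega_1\mid\text{no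 }\mu'\in\Omega_2\text{ compatible with }\mu\}$; $\mathsf{FILTER}$ selects the mappings satisfying $R$; $[\![\mathsf{GRAPH}\ u\ P_1]\!]^{\mathfrak D}_G=[\![P_1]\!]^{\mathfrak D}_{G_u}$ ($G_u=\emptyset$ if $u$ is not a name in $\mathfrak D$); $[\![\mathsf{GRAPH}\ ?x\ P_1]\!]^{\mathfrak D}_G=\bigcup_{u\text{ name in }\mathfrak D}([\![P_1]\!]^{\mathfrak D}_{G_u}\Join\{\{?x\mapsto u\}\})$; $\mathsf{BIND}$ extends each mapping $\mu$ by $?v\mapsto\mu[e]$ (leaving $\mu$ unchanged if $e$ is an unbound variable). $[\![P]\!]_G$ (without dataset) means evaluation over $G$ in the dataset with default graph $G$ and no named graphs. **LDQL.** A link pattern is a tuple in $(\mathcal U\cup\{\_,+\})\times(\mathcal U\cup\{\_,+\})\times(\mathcal U\cup\mathcal L\cup\{\_,+\})$. An edge with label $(\langle x_1,x_2,x_3\rangle,u)$ matches $\langle y_1,y_2,y_3\rangle$ in the context of URI $u_c$ if (1) some $i$ has $y_i=\_$ and $x_i=u$, and (2) for each $i$: $y_i=+$ and $x_i=u_c$, or $y_i=x_i$, or $y_i=\_$. LDQL queries $q$ and link path expressions (LPEs) $lpe$ are given by $q:=\langle lpe,P\rangle\mid(\mathsf{SEED}\ U\ q)\mid(\mathsf{SEED}\ ?v\ q)\mid(q\,\mathsf{AND}\,q)\mid(q\,\mathsf{UNION}\,q)\mid\pi_Vq$, $lpe:=\varepsilon\mid lp\mid lpe/lpe\mid lpe|lpe\mid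 lpe^*\mid[lpe]\mid\langle ?v,q\rangle$, with $lp$ a link pattern, $P$ a graph pattern, $U$ a finite set of URIs, $V$ a finite set of variables. $\mathrm{dataset}_W(U)$ is the dataset with default graph $\bigcup_{u\in U\cap\mathrm{dom}(adoc)}\mathrm{data}(adoc(u))$ and named graphs $\langle u,\mathrm{data}(adoc(u))\rangle$ for $u\in U\cap\mathrm{dom}(adoc)$. For finite $S\subseteq\mathcal U$: $[\![\langle lpe,P\rangle]\!]^S_W=[\![P]\!]^{\mathfrak D}_G$ with $\mathfrak D=\mathrm{dataset}_W(\bigcup_{u\in S}[\![lpe]\!]^u_W)$ and $G$ its default graph; $[\![(\mathsf{SEED}\ U\ q)]\!]^S_W=[\![q]\!]^U_W$; $[\![(\mathsf{SEED}\ ?v\ q)]\!]^S_W=\bigcup_{u\in\mathcal U}([\![q]\!]^{\{u\}}_W\Join\{\{?v\mapsto u\}\})$; $\mathsf{UNION}$ is $\cup$; $\mathsf{AND}$ is $\Join$; $[\![\pi_Vq]\!]^S_W$ consists of the restrictions of the mappings in $[\![q]\!]^S_W$ to $V$. For $u_c\in\mathrm{dom}(adoc)$: $[\![\varepsilon]\!]^{u_c}_W=\{u_c\}$; $[\![lp]\!]^{u_c}_W$ is the set of URIs $u$ such that some edge $\langle adoc(u_c),(t,u),d'\rangle\in\mathcal G_W$ matches $lp$ in the context of $u_c$; $[\![l_1/l_2]\!]^{u_c}_W=\bigcup_{u'\in[\![l_1]\!]^{u_c}_W}[\![l_2]\!]^{u'}_W$; $[\![l_1|l_2]\!]^{u_c}_W$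 is the union; $[\![l^*]\!]^{u_c}_W=\{u_c\}\cup[\![l]\!]^{u_c}_W\cup[\![l/l]\!]^{u_c}_W\cup\cdots$; $[\![[l]]\!]^{u_c}_W=\{u_c\}$ if $[\![l]\!]^{u_c}_W\ne\emptyset$, else $\emptyset$; $[\![\langle ?v,q\rangle]\!]^{u_c}_W=\{u\in\mathcal U\mid\mu(?v)=u\text{ for some }\mu\in[\![q]\!]^{\{u_c\}}_W\}$. If $u_c\notin\mathrm{dom}(adoc)$ then $[\![lpe]\!]^{u_c}_W=\emptyset$. **Reachability-based semantics.** Let $\mathcal P$ be the set of all SPARQL graph patterns. A reachability criterion is a function $c:\mathcal T\times\mathcal U\times\mathcal P\to\{\mathrm{true},\mathrm{false}\}$. $c_{\mathsf{All}}$ is constantly true, $c_{\mathsf{None}}$ constantly false, and $c_{\mathsf{Match}}(t,u,P)=\mathrm{true}$ iff there are a triple pattern $tp$ contained in $P$ and a solution mapping $\mu$ with $\mu[tp]=t$. For finite $S\subseteq\mathcal U$, the $(c,S,P)$-reachable documents in $W$ form the smallest set such that: (1) $adoc(u)$ is reachable for each $u\in S\cap\mathrm{dom}(adoc)$; (2) if $\langle d,(t,u),d'\rangle\in\mathcal G_W$, $d$ is reachable and $c(t,u,P)=\mathrm{true}$, then $d'$ is reachable. $[\![P]\!]^{\mathsf R(c,S)}_W=[\![P]\!]_G$, where $G$ is the union of $\mathrm{data}(d)$ over all $(c,S,P)$-reachable documents $d$ in $W$. *)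

theory Defs
  imports Main "HOL-Library.FSet"
begin

section \<open>RDF data\<close>

text \<open>The sets of URIs, blank nodes, literals, variables and documents are the type variables
  \<open>'u\<close>, \<open>'b\<close>, \<open>'l\<close>, \<open>'v\<close> and \<open>'d\<close>; disjointness is by typing, and infinity is assumed where
  it belongs, in the theorem.\<close>

datatype ('u, 'b, 'l) rdf_term = Uri 'u | Blank 'b | Lit 'l

type_synonym ('u, 'b, 'l) triple =
  "('u, 'b, 'l) rdf_term \<times> ('u, 'b, 'l) rdf_term \<times> ('u, 'b, 'l) rdf_term"

text \<open>The type \<open>triple\<close> admits arbitrary terms in each position; proper RDF triples form this
  set.\<close>

definition rdf_triples :: "('u, 'b, 'l) triple set" where
  "rdf_triples = (range Uri \<union> range Blank) \<times> range Uri \<times> UNIV"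

fun terms_of :: "('u, 'b, 'l) triple \<Rightarrow> ('u, 'b, 'l) rdf_term set" where
  "terms_of (s, p, ob) = {s, p, ob}"

definition uris :: "('u, 'b, 'l) triple \<Rightarrow> 'u set" where
  "uris t = {u. Uri u \<in> terms_of t}"

definition blanks :: "('u, 'b, 'l) triple set \<Rightarrow> 'b set" where
  "blanks G = {b. \<exists>t\<in>G. Blank b \<in> terms_of t}"


section \<open>Webs of Linked Data\<close>

text \<open>The assignment of triples to documents is a component of the Web, so that quantifying over
  Webs also quantifies over it.\<close>

record ('u, 'b, 'l, 'd) web =
  docs :: "'d set"
  adoc :: "'u \<rightharpoonup> 'd"
  doc_data :: "'d \<Rightarrow> ('u, 'b, 'l) triple set"

definition web_of_linked_data :: "('u, 'b, 'l, 'd) web \<Rightarrow> bool" where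
  "web_of_linked_data W \<longleftrightarrow>
     finite (docs W) \<and>
     ran (adoc W) = docs W \<and>
     (\<forall>d. finite (doc_data W d) \<and> doc_data W d \<subseteq> rdf_triples) \<and>
     (\<forall>d d'. d \<noteq> d' \<longrightarrow> blanks (doc_data W d) \<inter> blanks (doc_data W d') = {})"

definition link_graph ::
  "('u, 'b, 'l, 'd) web \<Rightarrow> ('d \<times> (('u, 'b, 'l) triple \<times> 'u) \<times> 'd) set" where
  "link_graph W =
     {(d, (t, u), d') | d t u d'.
        d \<in> docs W \<and> t \<in> doc_data W d \<and> u \<in> uris t \<and> adoc W u = Some d'}"


section \<open>SPARQL\<close>

subsection \<open>Solution mappings\<close>

type_synonym ('u, 'b, 'l, 'v) mapping = "'v \<rightharpoonup> ('u, 'b, 'l) rdf_term"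

definition compatible :: "('u, 'b, 'l, 'v) mapping \<Rightarrow> ('u, 'b, 'l, 'v) mapping \<Rightarrow> bool" where
  "compatible \<mu> \<mu>' \<longleftrightarrow> (\<forall>x \<in> dom \<mu> \<inter> dom \<mu>'. \<mu> x = \<mu>' x)"

definition join ::
  "('u, 'b, 'l, 'v) mapping set \<Rightarrow> ('u, 'b, 'l, 'v) mapping set \<Rightarrow> ('u, 'b, 'l, 'v) mapping set" where
  "join \<Omega>1 \<Omega>2 = {\<mu>1 ++ \<mu>2 | \<mu>1 \<mu>2. \<mu>1 \<in> \<Omega>1 \<and> \<mu>2 \<in> \<Omega>2 \<and> compatible \<mu>1 \<mu>2}"

text \<open>Elements that may occur in a triple pattern or in its image under a mapping: an RDF term or
  a variable.\<close>

datatype ('u, 'b, 'l, 'v) node = Const "('u, 'b, 'l) rdf_term" | Var 'v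

type_synonym ('u, 'b, 'l, 'v) triple_pattern =
  "('u, 'b, 'l, 'v) node \<times> ('u, 'b, 'l, 'v) node \<times> ('u, 'b, 'l, 'v) node"

primrec subst :: "('u, 'b, 'l, 'v) mapping \<Rightarrow> ('u, 'b, 'l, 'v) node \<Rightarrow> ('u, 'b, 'l, 'v) node" where
  "subst \<mu> (Const a) = Const a"
| "subst \<mu> (Var x) = (case \<mu> x of Some a \<Rightarrow> Const a | None \<Rightarrow> Var x)"

fun subst_tp ::
  "('u, 'b, 'l, 'v) mapping \<Rightarrow> ('u, 'b, 'l, 'v) triple_pattern \<Rightarrow> ('u, 'b, 'l, 'v) triple_pattern" where
  "subst_tp \<mu> (s, p, ob) = (subst \<mu> s, subst \<mu> p, subst \<mu> ob)"

fun pattern_of_triple :: "('u, 'b, 'l) triple \<Rightarrow> ('u, 'b, 'l, 'v) triple_pattern" where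
  "pattern_of_triple (s, p, ob) = (Const s, Const p, Const ob)"

primrec node_vars :: "('u, 'b, 'l, 'v) node \<Rightarrow> 'v set" where
  "node_vars (Const a) = {}"
| "node_vars (Var x) = {x}"

fun tp_vars :: "('u, 'b, 'l, 'v) triple_pattern \<Rightarrow> 'v set" where
  "tp_vars (s, p, ob) = node_vars s \<union> node_vars p \<union> node_vars ob"

subsection \<open>Syntax\<close>

datatype ('u, 'b, 'l, 'v) filter_cond =
    Bound 'v
  | EqConst 'v "('u, 'b, 'l) rdf_term"
  | EqVar 'v 'v
  | FNot "('u, 'b, 'l, 'v) filter_cond"
  | FAnd "('u, 'b, 'l, 'v) filter_cond" "('u, 'b, 'l, 'v) filter_cond"
  | FOr "('u, 'b, 'l, 'v) filter_cond" "('u, 'b, 'l, 'v) filter_cond"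

datatype ('u, 'b, 'l, 'v) pattern =
    BGP "('u, 'b, 'l, 'v) triple_pattern fset"
  | PAnd "('u, 'b, 'l, 'v) pattern" "('u, 'b, 'l, 'v) pattern"
  | PUnion "('u, 'b, 'l, 'v) pattern" "('u, 'b, 'l, 'v) pattern"
  | POpt "('u, 'b, 'l, 'v) pattern" "('u, 'b, 'l, 'v) pattern"
  | PFilter "('u, 'b, 'l, 'v) pattern" "('u, 'b, 'l, 'v) filter_cond"
  | PGraphUri 'u "('u, 'b, 'l, 'v) pattern"
  | PGraphVar 'v "('u, 'b, 'l, 'v) pattern"
  | PBind "('u, 'b, 'l, 'v) pattern" "('u, 'b, 'l, 'v) node" 'v

primrec filter_vars :: "('u, 'b, 'l, 'v) filter_cond \<Rightarrow> 'v set" where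
  "filter_vars (Bound x) = {x}"
| "filter_vars (EqConst x a) = {x}"
| "filter_vars (EqVar x y) = {x, y}"
| "filter_vars (FNot R) = filter_vars R"
| "filter_vars (FAnd R1 R2) = filter_vars R1 \<union> filter_vars R2"
| "filter_vars (FOr R1 R2) = filter_vars R1 \<union> filter_vars R2"

primrec pattern_vars :: "('u, 'b, 'l, 'v) pattern \<Rightarrow> 'v set" where
  "pattern_vars (BGP B) = (\<Union>tp \<in> fset B. tp_vars tp)"
| "pattern_vars (PAnd P1 P2) = pattern_vars P1 \<union> pattern_vars P2"
| "pattern_vars (PUnion P1 P2) = pattern_vars P1 \<union> pattern_vars P2"
| "pattern_vars (POpt P1 P2) = pattern_vars P1 \<union> pattern_vars P2"
| "pattern_vars (PFilter P R) = pattern_vars P \<union> filter_vars R"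
| "pattern_vars (PGraphUri u P) = pattern_vars P"
| "pattern_vars (PGraphVar x P) = insert x (pattern_vars P)"
| "pattern_vars (PBind P e x) = insert x (node_vars e \<union> pattern_vars P)"

primrec pattern_tps :: "('u, 'b, 'l, 'v) pattern \<Rightarrow> ('u, 'b, 'l, 'v) triple_pattern set" where
  "pattern_tps (BGP B) = fset B"
| "pattern_tps (PAnd P1 P2) = pattern_tps P1 \<union> pattern_tps P2"
| "pattern_tps (PUnion P1 P2) = pattern_tps P1 \<union> pattern_tps P2"
| "pattern_tps (POpt P1 P2) = pattern_tps P1 \<union> pattern_tps P2"
| "pattern_tps (PFilter P R) = pattern_tps P"
| "pattern_tps (PGraphUri u P) = pattern_tps P"
| "pattern_tps (PGraphVar x P) = pattern_tps P"
| "pattern_tps (PBind P e x) = pattern_tps P"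

text \<open>The datatypes are more permissive than the grammar: blank nodes are excluded from patterns,
  literals from predicate positions, and the variable introduced by \<open>PBind\<close> must be fresh. The
  predicate \<open>graph_pattern\<close> singles out the legal patterns.\<close>

definition uri_lit_var :: "('u, 'b, 'l, 'v) node set" where
  "uri_lit_var = range (Const \<circ> Uri) \<union> range (Const \<circ> Lit) \<union> range Var"

definition uri_var :: "('u, 'b, 'l, 'v) node set" where
  "uri_var = range (Const \<circ> Uri) \<union> range Var"

definition triple_patterns :: "('u, 'b, 'l, 'v) triple_pattern set" where
  "triple_patterns = uri_lit_var \<times> uri_var \<times> uri_lit_var"

primrec filter_condition :: "('u, 'b, 'l, 'v) filter_cond \<Rightarrow> bool" where
  "filter_condition (Bound x) \<longleftrightarrow> True"
| "filter_condition (EqConst x a) \<longleftrightarrow> a \<in> range Uri \<union> range Lit"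
| "filter_condition (EqVar x y) \<longleftrightarrow> True"
| "filter_condition (FNot R) \<longleftrightarrow> filter_condition R"
| "filter_condition (FAnd R1 R2) \<longleftrightarrow> filter_condition R1 \<and> filter_condition R2"
| "filter_condition (FOr R1 R2) \<longleftrightarrow> filter_condition R1 \<and> filter_condition R2"

primrec graph_pattern :: "('u, 'b, 'l, 'v) pattern \<Rightarrow> bool" where
  "graph_pattern (BGP B) \<longleftrightarrow> fset B \<subseteq> triple_patterns"
| "graph_pattern (PAnd P1 P2) \<longleftrightarrow> graph_pattern P1 \<and> graph_pattern P2"
| "graph_pattern (PUnion P1 P2) \<longleftrightarrow> graph_pattern P1 \<and> graph_pattern P2"
| "graph_pattern (POpt P1 P2) \<longleftrightarrow> graph_pattern P1 \<and> graph_pattern P2"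
| "graph_pattern (PFilter P R) \<longleftrightarrow> graph_pattern P \<and> filter_condition R"
| "graph_pattern (PGraphUri u P) \<longleftrightarrow> graph_pattern P"
| "graph_pattern (PGraphVar x P) \<longleftrightarrow> graph_pattern P"
| "graph_pattern (PBind P e x) \<longleftrightarrow>
     graph_pattern P \<and> e \<in> uri_lit_var \<and> x \<notin> pattern_vars P"

subsection \<open>Evaluation\<close>

record ('u, 'b, 'l) dataset =
  default_graph :: "('u, 'b, 'l) triple set"
  named_graphs :: "'u \<rightharpoonup> ('u, 'b, 'l) triple set"

definition named_graph :: "('u, 'b, 'l) dataset \<Rightarrow> 'u \<Rightarrow> ('u, 'b, 'l) triple set" where
  "named_graph \<DD> u = (case named_graphs \<DD> u of Some G \<Rightarrow> G | None \<Rightarrow> {})"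

primrec satisfies :: "('u, 'b, 'l, 'v) mapping \<Rightarrow> ('u, 'b, 'l, 'v) filter_cond \<Rightarrow> bool" where
  "satisfies \<mu> (Bound x) \<longleftrightarrow> x \<in> dom \<mu>"
| "satisfies \<mu> (EqConst x a) \<longleftrightarrow> \<mu> x = Some a"
| "satisfies \<mu> (EqVar x y) \<longleftrightarrow> x \<in> dom \<mu> \<and> y \<in> dom \<mu> \<and> \<mu> x = \<mu> y"
| "satisfies \<mu> (FNot R) \<longleftrightarrow> \<not> satisfies \<mu> R"
| "satisfies \<mu> (FAnd R1 R2) \<longleftrightarrow> satisfies \<mu> R1 \<and> satisfies \<mu> R2"
| "satisfies \<mu> (FOr R1 R2) \<longleftrightarrow> satisfies \<mu> R1 \<or> satisfies \<mu> R2"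

definition bind ::
  "('u, 'b, 'l, 'v) node \<Rightarrow> 'v \<Rightarrow> ('u, 'b, 'l, 'v) mapping \<Rightarrow> ('u, 'b, 'l, 'v) mapping" where
  "bind e x \<mu> = (case subst \<mu> e of Const a \<Rightarrow> \<mu>(x \<mapsto> a) | Var y \<Rightarrow> \<mu>)"

primrec eval_pattern ::
  "('u, 'b, 'l) dataset \<Rightarrow> ('u, 'b, 'l) triple set \<Rightarrow> ('u, 'b, 'l, 'v) pattern
     \<Rightarrow> ('u, 'b, 'l, 'v) mapping set" where
  "eval_pattern \<DD> G (BGP B) =
     {\<mu>. dom \<mu> = pattern_vars (BGP B) \<and> subst_tp \<mu> ` fset B \<subseteq> pattern_of_triple ` G}"
| "eval_pattern \<DD> G (PAnd P1 P2) = join (eval_pattern \<DD> G P1) (eval_pattern \<DD> G P2)"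
| "eval_pattern \<DD> G (PUnion P1 P2) = eval_pattern \<DD> G P1 \<union> eval_pattern \<DD> G P2"
| "eval_pattern \<DD> G (POpt P1 P2) =
     join (eval_pattern \<DD> G P1) (eval_pattern \<DD> G P2) \<union>
     {\<mu> \<in> eval_pattern \<DD> G P1. \<not> (\<exists>\<mu>' \<in> eval_pattern \<DD> G P2. compatible \<mu>' \<mu>)}"
| "eval_pattern \<DD> G (PFilter P R) = {\<mu> \<in> eval_pattern \<DD> G P. satisfies \<mu> R}"
| "eval_pattern \<DD> G (PGraphUri u P) = eval_pattern \<DD> (named_graph \<DD> u) P"
| "eval_pattern \<DD> G (PGraphVar x P) =
     (\<Union>u \<in> dom (named_graphs \<DD>). join (eval_pattern \<DD> (named_graph \<DD> u) P) {[x \<mapsto> Uri u]})"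
| "eval_pattern \<DD> G (PBind P e x) = bind e x ` eval_pattern \<DD> G P"

definition eval_over_graph ::
  "('u, 'b, 'l) triple set \<Rightarrow> ('u, 'b, 'l, 'v) pattern \<Rightarrow> ('u, 'b, 'l, 'v) mapping set" where
  "eval_over_graph G P =
     eval_pattern \<lparr>default_graph = G, named_graphs = Map.empty\<rparr> G P"


section \<open>LDQL\<close>

subsection \<open>Link patterns\<close>

text \<open>\<open>Wildcard\<close> and \<open>Context\<close> are the symbols written as an underscore and a plus sign.\<close>

datatype ('u, 'b, 'l) link_pos = Wildcard | Context | Fixed "('u, 'b, 'l) rdf_term"

type_synonym ('u, 'b, 'l) link_pattern =
  "('u, 'b, 'l) link_pos \<times> ('u, 'b, 'l) link_pos \<times> ('u, 'b, 'l) link_pos"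

definition link_patterns :: "('u, 'b, 'l) link_pattern set" where
  "link_patterns =
     (range (Fixed \<circ> Uri) \<union> {Wildcard, Context}) \<times>
     (range (Fixed \<circ> Uri) \<union> {Wildcard, Context}) \<times>
     (range (Fixed \<circ> Uri) \<union> range (Fixed \<circ> Lit) \<union> {Wildcard, Context})"

definition pos_matches ::
  "'u \<Rightarrow> ('u, 'b, 'l) rdf_term \<Rightarrow> ('u, 'b, 'l) link_pos \<Rightarrow> bool" where
  "pos_matches uc x y \<longleftrightarrow> (y = Context \<and> x = Uri uc) \<or> y = Fixed x \<or> y = Wildcard"

fun link_matches ::
  "'u \<Rightarrow> ('u, 'b, 'l) triple \<times> 'u \<Rightarrow> ('u, 'b, 'l) link_pattern \<Rightarrow> bool" where
  "link_matches uc ((x1, x2, x3), u) (y1, y2, y3) \<longleftrightarrow>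
     ((y1 = Wildcard \<and> x1 = Uri u) \<or> (y2 = Wildcard \<and> x2 = Uri u) \<or> (y3 = Wildcard \<and> x3 = Uri u)) \<and>
     pos_matches uc x1 y1 \<and> pos_matches uc x2 y2 \<and> pos_matches uc x3 y3"

subsection \<open>Syntax\<close>

datatype ('u, 'b, 'l, 'v) query =
    QBase "('u, 'b, 'l, 'v) lpe" "('u, 'b, 'l, 'v) pattern"
  | QSeedUris "'u fset" "('u, 'b, 'l, 'v) query"
  | QSeedVar 'v "('u, 'b, 'l, 'v) query"
  | QAnd "('u, 'b, 'l, 'v) query" "('u, 'b, 'l, 'v) query"
  | QUnion "('u, 'b, 'l, 'v) query" "('u, 'b, 'l, 'v) query"
  | QProj "'v fset" "('u, 'b, 'l, 'v) query"
and ('u, 'b, 'l, 'v) lpe =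
    LEps
  | LLink "('u, 'b, 'l) link_pattern"
  | LSeq "('u, 'b, 'l, 'v) lpe" "('u, 'b, 'l, 'v) lpe"
  | LAlt "('u, 'b, 'l, 'v) lpe" "('u, 'b, 'l, 'v) lpe"
  | LStar "('u, 'b, 'l, 'v) lpe"
  | LTest "('u, 'b, 'l, 'v) lpe"
  | LQuery 'v "('u, 'b, 'l, 'v) query"

primrec ldql_query :: "('u, 'b, 'l, 'v) query \<Rightarrow> bool"
  and link_path_expr :: "('u, 'b, 'l, 'v) lpe \<Rightarrow> bool" where
  "ldql_query (QBase l P) \<longleftrightarrow> link_path_expr l \<and> graph_pattern P"
| "ldql_query (QSeedUris U q) \<longleftrightarrow> ldql_query q"
| "ldql_query (QSeedVar x q) \<longleftrightarrow> ldql_query q"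
| "ldql_query (QAnd q1 q2) \<longleftrightarrow> ldql_query q1 \<and> ldql_query q2"
| "ldql_query (QUnion q1 q2) \<longleftrightarrow> ldql_query q1 \<and> ldql_query q2"
| "ldql_query (QProj V q) \<longleftrightarrow> ldql_query q"
| "link_path_expr LEps \<longleftrightarrow> True"
| "link_path_expr (LLink lp) \<longleftrightarrow> lp \<in> link_patterns"
| "link_path_expr (LSeq l1 l2) \<longleftrightarrow> link_path_expr l1 \<and> link_path_expr l2"
| "link_path_expr (LAlt l1 l2) \<longleftrightarrow> link_path_expr l1 \<and> link_path_expr l2"
| "link_path_expr (LStar l) \<longleftrightarrow> link_path_expr l"
| "link_path_expr (LTest l) \<longleftrightarrow> link_path_expr l"
| "link_path_expr (LQuery x q) \<longleftrightarrow> ldql_query q"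

subsection \<open>Evaluation\<close>

definition dataset_of :: "('u, 'b, 'l, 'd) web \<Rightarrow> 'u set \<Rightarrow> ('u, 'b, 'l) dataset" where
  "dataset_of W U =
     \<lparr>default_graph = (\<Union>u \<in> U \<inter> dom (adoc W). doc_data W (the (adoc W u))),
      named_graphs = (\<lambda>u. if u \<in> U then map_option (doc_data W) (adoc W u) else None)\<rparr>"

text \<open>In the clause for \<open>LStar\<close>, the \<open>n\<close>-th iterate applied to \<open>{uc}\<close> is the value of the \<open>n\<close>-fold
  concatenation of \<open>l\<close> with itself.\<close>

primrec eval_query ::
  "('u, 'b, 'l, 'd) web \<Rightarrow> 'u set \<Rightarrow> ('u, 'b, 'l, 'v) query \<Rightarrow> ('u, 'b, 'l, 'v) mapping set"
  and eval_lpe :: "('u, 'b, 'l, 'd) web \<Rightarrow> 'u \<Rightarrow> ('u, 'b, 'l, 'v) lpe \<Rightarrow> 'u set" where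
  "eval_query W S (QBase l P) =
     (let \<DD> = dataset_of W (\<Union>u \<in> S. eval_lpe W u l) in eval_pattern \<DD> (default_graph \<DD>) P)"
| "eval_query W S (QSeedUris U q) = eval_query W (fset U) q"
| "eval_query W S (QSeedVar x q) = (\<Union>u. join (eval_query W {u} q) {[x \<mapsto> Uri u]})"
| "eval_query W S (QAnd q1 q2) = join (eval_query W S q1) (eval_query W S q2)"
| "eval_query W S (QUnion q1 q2) = eval_query W S q1 \<union> eval_query W S q2"
| "eval_query W S (QProj V q) = (\<lambda>\<mu>. \<mu> |` fset V) ` eval_query W S q"
| "eval_lpe W uc LEps = (if uc \<in> dom (adoc W) then {uc} else {})"
| "eval_lpe W uc (LLink lp) =
     (if uc \<in> dom (adoc W)
      then {u. \<exists>t d'. (the (adoc W uc), (t, u), d') \<in> link_graph W \<and> link_matches uc (t, u) lp}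
      else {})"
| "eval_lpe W uc (LSeq l1 l2) =
     (if uc \<in> dom (adoc W) then \<Union>u' \<in> eval_lpe W uc l1. eval_lpe W u' l2 else {})"
| "eval_lpe W uc (LAlt l1 l2) =
     (if uc \<in> dom (adoc W) then eval_lpe W uc l1 \<union> eval_lpe W uc l2 else {})"
| "eval_lpe W uc (LStar l) =
     (if uc \<in> dom (adoc W)
      then \<Union>n. ((\<lambda>A. \<Union>u' \<in> A. eval_lpe W u' l) ^^ n) {uc}
      else {})"
| "eval_lpe W uc (LTest l) =
     (if uc \<in> dom (adoc W) \<and> eval_lpe W uc l \<noteq> {} then {uc} else {})"
| "eval_lpe W uc (LQuery x q) =
     (if uc \<in> dom (adoc W) then {u. \<exists>\<mu> \<in> eval_query W {uc} q. \<mu> x = Some (Uri u)} else {})"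


section \<open>Reachability-based semantics\<close>

type_synonym ('u, 'b, 'l, 'v) criterion =
  "('u, 'b, 'l) triple \<Rightarrow> 'u \<Rightarrow> ('u, 'b, 'l, 'v) pattern \<Rightarrow> bool"

definition c_All :: "('u, 'b, 'l, 'v) criterion" where
  "c_All t u P \<longleftrightarrow> True"

definition c_None :: "('u, 'b, 'l, 'v) criterion" where
  "c_None t u P \<longleftrightarrow> False"

definition c_Match :: "('u, 'b, 'l, 'v) criterion" where
  "c_Match t u P \<longleftrightarrow>
     (\<exists>tp \<in> pattern_tps P. \<exists>\<mu>. finite (dom \<mu>) \<and> subst_tp \<mu> tp = pattern_of_triple t)"

inductive_set reachable ::
  "('u, 'b, 'l, 'v) criterion \<Rightarrow> 'u set \<Rightarrow> ('u, 'b, 'l, 'v) pattern \<Rightarrow> ('u, 'b, 'l, 'd) web \<Rightarrow> 'd set"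
  for c S P W where
  seed: "u \<in> S \<Longrightarrow> adoc W u = Some d \<Longrightarrow> d \<in> reachable c S P W"
| link: "d \<in> reachable c S P W \<Longrightarrow> (d, (t, u), d') \<in> link_graph W \<Longrightarrow> c t u P
     \<Longrightarrow> d' \<in> reachable c S P W"

definition eval_reach ::
  "('u, 'b, 'l, 'v) criterion \<Rightarrow> 'u set \<Rightarrow> ('u, 'b, 'l, 'd) web \<Rightarrow> ('u, 'b, 'l, 'v) pattern
     \<Rightarrow> ('u, 'b, 'l, 'v) mapping set" where
  "eval_reach c S W P = eval_over_graph (\<Union>d \<in> reachable c S P W. doc_data W d) P"

end

theory Submission
  imports Defs
begin

text \<open>The reachability-based semantics sees a Web only through the union of the data of the
  reachable documents, whereas \<open>\<langle>\<epsilon>, GRAPH ?x {}\<rangle>\<close> returns the seed URIs themselves. In a Web whose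
  only document is empty, the former cannot tell the seed sets \<open>{}\<close> and \<open>{u}\<close> apart, the latter
  can.\<close>

text \<open>Exhibits the empty pattern as the unit of \<open>join\<close>, whatever the graph; the
  raw BGP clause would hide this.\<close>

lemma eval_pattern_empty_BGP [simp]: "eval_pattern \<DD> G (BGP {||}) = {Map.empty}"
  by auto

lemma join_empty_mapping [simp]: "join {Map.empty} \<Omega> = \<Omega>"
  by (auto simp: join_def compatible_def)

text \<open>Under \<open>LEps\<close> each seed with a document names a graph, and the empty pattern
  succeeds in it even when that graph has no triples.\<close>

lemma eval_query_names:
  "eval_query W S (QBase LEps (PGraphVar x (BGP {||}))) =
     (\<lambda>u. [x \<mapsto> Uri u]) ` (S \<inter> dom (adoc W))"
  by (auto simp: Let_def dataset_of_def dom_def simp del: eval_pattern.simps(1) split: if_splits)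

lemma eval_reach_no_data:
  assumes "\<And>d. doc_data W d = {}"
  shows "eval_reach c S W P = eval_over_graph {} P"
  using assms by (simp add: eval_reach_def)

theorem theorem6:
  fixes c :: "('u, 'b, 'l, 'v) criterion"
  assumes "infinite (UNIV :: 'u set)" and "infinite (UNIV :: 'b set)"
    and "infinite (UNIV :: 'l set)" and "infinite (UNIV :: 'v set)"
    and "infinite (UNIV :: 'd set)"
    and "c \<in> {c_All, c_None, c_Match}"
  shows "\<exists>q :: ('u, 'b, 'l, 'v) query. ldql_query q \<and>
    \<not> (\<exists>P :: ('u, 'b, 'l, 'v) pattern. graph_pattern P \<and>
         (\<forall>W :: ('u, 'b, 'l, 'd) web. web_of_linked_data W \<longrightarrow>
            (\<forall>S. finite S \<longrightarrow> eval_reach c S W P = eval_query W S q)))"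
proof (intro exI conjI notI)
  fix x :: 'v
  let ?q = "QBase LEps (PGraphVar x (BGP {||})) :: ('u, 'b, 'l, 'v) query"
  show "ldql_query ?q"
    by simp
  assume "\<exists>P :: ('u, 'b, 'l, 'v) pattern. graph_pattern P \<and>
         (\<forall>W :: ('u, 'b, 'l, 'd) web. web_of_linked_data W \<longrightarrow>
            (\<forall>S. finite S \<longrightarrow> eval_reach c S W P = eval_query W S ?q))"
  then obtain P :: "('u, 'b, 'l, 'v) pattern" where
    P: "\<And>(W :: ('u, 'b, 'l, 'd) web) S. web_of_linked_data W \<Longrightarrow> finite S \<Longrightarrow>
          eval_reach c S W P = eval_query W S ?q"
    by blast
  fix u :: 'u and d :: 'd
  define W :: "('u, 'b, 'l, 'd) web" where
    "W = \<lparr>docs = {d}, adoc = [u \<mapsto> d], doc_data = \<lambda>_. {}\<rparr>"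
  have W: "web_of_linked_data W"
    by (simp add: web_of_linked_data_def W_def blanks_def)
  \<comment> \<open>Both sides equal \<open>eval_over_graph {} P\<close>, since \<open>P\<close> was
    fixed before \<open>W\<close> and the seeds.\<close>
  have "eval_query W {} ?q = eval_query W {u} ?q"
    using P[OF W, of "{}"] P[OF W, of "{u}"] by (simp add: eval_reach_no_data W_def)
  then show False
    \<comment> \<open>The left side is empty, the right side contains
      \<open>[x \<mapsto> Uri u]\<close>.\<close>
    by (simp only: eval_query_names) (simp add: W_def)
qed

end
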